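(* Let $d\ge 2$. Consider the POVMs $E$ with finitely many outcomes on $\mathbb{C}^d\otimes\mathbb{C}^d$ which determine whether a state is CQ, i.e., for which there do not exist a CQ state $\varrho_1$ and a non-CQ state $\varrho_2$ with $\mathrm{tr}[\varrho_1E_j]=\mathrm{tr}[\varrho_2E_j]$ for all outcomes $j$. Then: (i) there exists such a POVM that is not informationally complete; (ii) the minimal number of outcomes among all such POVMs is $d^4-d^2+1$ (that is, there is such a POVM with $d^4-d^2+1$ outcomes, and none with fewer outcomes). The same statements hold with CQ replaced by QC.
   Context: A state on a finite-dimensional Hilbert space is a positive semidefinite operator of trace one. A POVM with finitely many outcomes is a finite family $(E_j)$ of positive semidefinite operators on $\mathbb{C}^d\otimes\mathbb{C}^d$ with $\sum_j E_j=\mathbb{1}$; measuring it in the state $\varrho$ gives outcome $j$ with probability $\mathrm{tr}[\varrho E_j]$. Put $\mathcal{X}_E=\{\Delta \text{ Hermitian} \mid \mathrm{tr}[\Delta E_j]=0 \text{ for all } j\}$. $E$ is informationally complete if $\mathcal{X}_E=\{0\}$; equivalently, any two distinct states yield different outcome probabilities. A state $\varrho$ on $\mathbb{C}^d\otimes\mathbb{C}^d$ is classical-quantum (CQ) if $\varrho=\sum_{i=1}^d c_i|\phi_i\rangle\langle\phi_i|\otimes\eta_i$ for some orthonormal basis $\{|\phi_i\rangle\}_{i=1}^d$ of $\mathbb{C}^d$, states $\eta_i$ on $\mathbb{C}^d$ and $c_i\ge0$, $\sum_ic_i=1$. It is quantum-classical (QC) if $\varrho=\sum_{i=1}^d c_i\,\sigma_i\otimes|\varphi_i\rangle\langle\varphi_i|$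 for some orthonormal basis $\{|\varphi_i\rangle\}_{i=1}^d$ of $\mathbb{C}^d$, states $\sigma_i$ on $\mathbb{C}^d$ and $c_i\ge0$, $\sum_ic_i=1$. *)

theory Defs
  imports "HOL-Analysis.Analysis"
begin

text \<open>
  Operators on the Hilbert space \<open>\<complex>\<^sup>n\<close> are complex square matrices over a finite index type.
  Since \<open>\<complex>\<^sup>d \<otimes> \<complex>\<^sup>d\<close> has the product basis indexed by pairs, its operators are matrices indexed
  by \<open>'n \<times> 'n\<close>, where \<open>CARD('n) = d\<close>.
\<close>

type_synonym 'n op = "complex ^ 'n ^ 'n"
type_synonym 'n bipartite_op = "('n \<times> 'n) op"

definition cinner :: "complex ^ 'n \<Rightarrow> complex ^ 'n \<Rightarrow> complex" where
  "cinner u v = (\<Sum>i\<in>UNIV. cnj (u $ i) * v $ i)"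

definition hermitian :: "('n::finite) op \<Rightarrow> bool" where
  "hermitian A \<longleftrightarrow> (\<forall>i j. A $ i $ j = cnj (A $ j $ i))"

definition psd :: "('n::finite) op \<Rightarrow> bool" where
  "psd A \<longleftrightarrow> hermitian A \<and> (\<forall>v. 0 \<le> Re (cinner v (A *v v)))"

definition state :: "('n::finite) op \<Rightarrow> bool" where
  "state \<rho> \<longleftrightarrow> psd \<rho> \<and> trace \<rho> = 1"

definition orthonormal_basis :: "('n \<Rightarrow> complex ^ 'n) \<Rightarrow> bool" where
  "orthonormal_basis \<phi> \<longleftrightarrow>
     (\<forall>i j. cinner (\<phi> i) (\<phi> j) = (if i = j then 1 else 0)) \<and> vec.span (range \<phi>) = UNIV"

text \<open>The operator \<open>|u\<rangle>\<langle>u|\<close>.\<close>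

definition ketbra :: "complex ^ 'n \<Rightarrow> ('n::finite) op" where
  "ketbra u = (\<chi> i j. u $ i * cnj (u $ j))"

definition tensor_op :: "('n::finite) op \<Rightarrow> 'n op \<Rightarrow> 'n bipartite_op" where
  "tensor_op A B = (\<chi> p q. A $ fst p $ fst q * B $ snd p $ snd q)"

definition is_CQ :: "('n::finite) bipartite_op \<Rightarrow> bool" where
  "is_CQ \<rho> \<longleftrightarrow>
     (\<exists>\<phi> \<eta> (c :: 'n \<Rightarrow> real).
        orthonormal_basis \<phi> \<and> (\<forall>i. state (\<eta> i)) \<and> (\<forall>i. 0 \<le> c i) \<and> (\<Sum>i\<in>UNIV. c i) = 1 \<and>
        \<rho> = (\<Sum>i\<in>UNIV. c i *\<^sub>R tensor_op (ketbra (\<phi> i)) (\<eta> i)))"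

definition is_QC :: "('n::finite) bipartite_op \<Rightarrow> bool" where
  "is_QC \<rho> \<longleftrightarrow>
     (\<exists>\<phi> \<sigma> (c :: 'n \<Rightarrow> real).
        orthonormal_basis \<phi> \<and> (\<forall>i. state (\<sigma> i)) \<and> (\<forall>i. 0 \<le> c i) \<and> (\<Sum>i\<in>UNIV. c i) = 1 \<and>
        \<rho> = (\<Sum>i\<in>UNIV. c i *\<^sub>R tensor_op (\<sigma> i) (ketbra (\<phi> i))))"

text \<open>A POVM with \<open>m\<close> outcomes is a family indexed by \<open>{..<m}\<close>; values \<open>E j\<close> with \<open>j \<ge> m\<close> are
  irrelevant here and below.\<close>

definition povm :: "nat \<Rightarrow> (nat \<Rightarrow> ('n::finite) op) \<Rightarrow> bool" where
  "povm m E \<longleftrightarrow> (\<forall>j<m. psd (E j)) \<and> (\<Sum>j<m. E j) = mat 1"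

definition undetected :: "nat \<Rightarrow> (nat \<Rightarrow> ('n::finite) op) \<Rightarrow> 'n op set" where
  "undetected m E = {\<Delta>. hermitian \<Delta> \<and> (\<forall>j<m. trace (\<Delta> ** E j) = 0)}"

definition informationally_complete :: "nat \<Rightarrow> (nat \<Rightarrow> ('n::finite) op) \<Rightarrow> bool" where
  "informationally_complete m E \<longleftrightarrow> undetected m E = {0}"

definition determines :: "nat \<Rightarrow> (nat \<Rightarrow> ('n::finite) op) \<Rightarrow> ('n op \<Rightarrow> bool) \<Rightarrow> bool" where
  "determines m E P \<longleftrightarrow>
     \<not> (\<exists>\<rho>\<^sub>1 \<rho>\<^sub>2. state \<rho>\<^sub>1 \<and> P \<rho>\<^sub>1 \<and> state \<rho>\<^sub>2 \<and> \<not> P \<rho>\<^sub>2 \<and>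
          (\<forall>j<m. trace (\<rho>\<^sub>1 ** E j) = trace (\<rho>\<^sub>2 ** E j)))"

end

theory Submission
  imports Defs
begin

text \<open>
  A POVM determines the CQ property if and only if its undetected operators all have the form
  \<open>1 \<otimes> B\<close>. Adding \<open>1 \<otimes> B\<close> keeps a state \<open>\<Sum>\<^sub>i |\<phi>\<^sub>i\<rangle>\<langle>\<phi>\<^sub>i| \<otimes> A\<^sub>i\<close> block diagonal in the same basis, because
  \<open>1 = \<Sum>\<^sub>i |\<phi>\<^sub>i\<rangle>\<langle>\<phi>\<^sub>i|\<close>. Conversely, the blocks \<open>\<langle>k|\<rho>|l\<rangle>\<close> of a CQ state over the second factor commute,
  and applying this to small perturbations of well-chosen CQ states by \<open>\<Delta>\<close> forces the blocks of an
  undetected \<open>\<Delta>\<close> to commute with all rank-one projections, hence to be scalar. Undetected operators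
  are traceless, so they span at most \<open>d\<^sup>2 - 1\<close> dimensions out of \<open>d\<^sup>4\<close>, which bounds the number of
  outcomes from below; the bound is attained because every real space of Hermitian operators that
  contains \<open>1\<close> is spanned by a POVM with as many outcomes as its dimension. The QC case is the CQ
  case with the two factors exchanged.
\<close>

section \<open>Quadratic forms, Hermitian and positive semidefinite matrices\<close>

lemma cinner_form: "cinner v (A *v v) = (\<Sum>i\<in>UNIV. \<Sum>j\<in>UNIV. cnj (v $ i) * A $ i $ j * v $ j)"
  by (simp add: cinner_def matrix_vector_mult_def sum_distrib_left mult.assoc)

lemma Re_cinner_self: "Re (cinner v v) = (norm v)\<^sup>2"
  by (simp add: cinner_def power2_norm_eq_inner inner_vec_def inner_complex_def)

lemma axis_nth: "axis i x $ j = (if j = i then x else 0)"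
  by (simp add: axis_def)

lemma mult_axis_nth: "(A *v axis i 1) $ j = (A $ j $ i :: complex)"
proof -
  have "(A *v axis i 1) $ j = (\<Sum>k\<in>UNIV. if k = i then A $ j $ k else 0)"
    unfolding matrix_vector_mult_def vec_lambda_beta by (intro sum.cong) (auto simp: axis_nth)
  then show ?thesis by simp
qed

lemma cinner_axis: "cinner (axis i 1) v = v $ i"
proof -
  have "cinner (axis i 1) v = (\<Sum>k\<in>UNIV. if k = i then v $ k else 0)"
    unfolding cinner_def by (intro sum.cong) (auto simp: axis_def)
  then show ?thesis by simp
qed

lemma cinner_matrix_add: "cinner v ((A + B) *v v) = cinner v (A *v v) + cinner v (B *v v)"
  unfolding cinner_form by (simp add: algebra_simps sum.distrib)

lemma cinner_matrix_scaleR: "cinner v ((t *\<^sub>R A) *v v) = of_real t * cinner v (A *v v)"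
  unfolding cinner_form sum_distrib_left
  by (intro sum.cong refl) (simp add: scaleR_conv_of_real[of t "_::complex"] mult_ac)

lemma hermitian_cnj: "hermitian A \<Longrightarrow> cnj (A $ i $ j) = A $ j $ i"
  unfolding hermitian_def by metis

lemma hermitianI: "(\<And>i j. cnj (A $ i $ j) = A $ j $ i) \<Longrightarrow> hermitian A"
  unfolding hermitian_def by metis

lemma hermitian_add: "hermitian A \<Longrightarrow> hermitian B \<Longrightarrow> hermitian (A + B)"
  by (rule hermitianI) (simp add: hermitian_cnj)

lemma hermitian_scaleR: "hermitian A \<Longrightarrow> hermitian (t *\<^sub>R A)"
  by (rule hermitianI) (simp add: hermitian_cnj)

lemma hermitian_diff: "hermitian A \<Longrightarrow> hermitian B \<Longrightarrow> hermitian (A - B)"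
  by (rule hermitianI) (simp add: hermitian_cnj)

lemma hermitian_zero: "hermitian 0"
  by (rule hermitianI) simp

lemma hermitian_mat_1: "hermitian (mat 1)"
  by (rule hermitianI) (auto simp: mat_def)

lemma subspace_hermitian: "subspace {A. hermitian A}"
  by (simp add: subspace_def hermitian_add hermitian_scaleR hermitian_zero)

lemma psd_add: "psd A \<Longrightarrow> psd B \<Longrightarrow> psd (A + B)"
  by (simp add: psd_def hermitian_add cinner_matrix_add)

lemma psd_scaleR: "psd A \<Longrightarrow> 0 \<le> t \<Longrightarrow> psd (t *\<^sub>R A)"
  by (simp add: psd_def hermitian_scaleR cinner_matrix_scaleR)

lemma psd_mat_1: "psd (mat 1)"
  by (simp add: psd_def hermitian_mat_1 Re_cinner_self)

lemma psd_zero: "psd 0"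
  by (simp add: psd_def hermitian_zero, simp add: cinner_def)

lemma psd_ketbra: "psd (ketbra u)"
proof -
  have "Re (cinner v (ketbra u *v v)) = (cmod (cinner u v))\<^sup>2" for v
  proof -
    have "cinner v (ketbra u *v v) = cnj (cinner u v) * cinner u v"
      unfolding cinner_form by (simp add: cinner_def ketbra_def sum_product mult_ac)
    also have "\<dots> = of_real ((cmod (cinner u v))\<^sup>2)"
      by (subst complex_norm_square) (rule mult.commute)
    finally show ?thesis by simp
  qed
  moreover have "hermitian (ketbra u)"
    by (rule hermitianI) (simp add: ketbra_def)
  ultimately show ?thesis by (simp add: psd_def)
qed

lemma quadratic_form_bounded:
  fixes A :: "('n::finite) op"
  shows "\<exists>K>0. \<forall>v. \<bar>Re (cinner v (A *v v))\<bar> \<le> K * (norm v)\<^sup>2"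
proof (intro exI conjI allI)
  let ?K = "\<Sum>i\<in>UNIV. \<Sum>j\<in>UNIV. cmod (A $ i $ j)"
  have "0 \<le> ?K" by (simp add: sum_nonneg)
  \<comment> \<open>The summand 1 keeps the constant positive even for \<open>A = 0\<close>; its
    reciprocal later bounds the size of a perturbation.\<close>
  then show "0 < 1 + ?K" by simp
  fix v
  have "\<bar>Re (cinner v (A *v v))\<bar> \<le> cmod (cinner v (A *v v))"
    by (rule abs_Re_le_cmod)
  also have "\<dots> \<le> (\<Sum>i\<in>UNIV. \<Sum>j\<in>UNIV. cmod (A $ i $ j) * (norm v)\<^sup>2)"
    unfolding cinner_form
  proof (intro sum_norm_le)
    fix i j
    have "cmod (v $ i) * cmod (v $ j) \<le> (norm v)\<^sup>2"
      unfolding power2_eq_square by (intro mult_mono Finite_Cartesian_Product.norm_nth_le norm_ge_zero)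
    then show "cmod (cnj (v $ i) * A $ i $ j * v $ j) \<le> cmod (A $ i $ j) * (norm v)\<^sup>2"
      using mult_left_mono[of "cmod (v $ i) * cmod (v $ j)" "(norm v)\<^sup>2" "cmod (A $ i $ j)"]
      by (simp add: norm_mult mult_ac)
  qed
  also have "\<dots> = ?K * (norm v)\<^sup>2" by (simp add: sum_distrib_right)
  also have "\<dots> \<le> (1 + ?K) * (norm v)\<^sup>2" by (simp add: mult_right_mono)
  finally show "\<bar>Re (cinner v (A *v v))\<bar> \<le> (1 + ?K) * (norm v)\<^sup>2" .
qed

text \<open>The identity is an interior point of the positive cone among Hermitian matrices: for
  \<open>\<bar>t\<bar> \<le> 1 / K\<close> the form of \<open>t *\<^sub>R A\<close> is dominated by
  the squared norm. Both signs of \<open>t\<close> are allowed.\<close>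

lemma psd_perturb_identity:
  fixes A :: "('n::finite) op"
  assumes "hermitian A"
  obtains e where "e > 0" "\<And>t. \<bar>t\<bar> \<le> e \<Longrightarrow> psd (mat 1 + t *\<^sub>R A)"
proof -
  obtain K where K: "K > 0" "\<And>v. \<bar>Re (cinner v (A *v v))\<bar> \<le> K * (norm v)\<^sup>2"
    using quadratic_form_bounded by blast
  have "psd (mat 1 + t *\<^sub>R A)" if t: "\<bar>t\<bar> \<le> 1 / K" for t
    unfolding psd_def
  proof (intro conjI allI)
    show "hermitian (mat 1 + t *\<^sub>R A)"
      by (intro hermitian_add hermitian_mat_1 hermitian_scaleR assms)
    fix v
    have "\<bar>t * Re (cinner v (A *v v))\<bar> \<le> 1 / K * (K * (norm v)\<^sup>2)"
      unfolding abs_mult using t K by (intro mult_mono) auto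
    also have "\<dots> = (norm v)\<^sup>2" using K(1) by simp
    finally show "0 \<le> Re (cinner v ((mat 1 + t *\<^sub>R A) *v v))"
      by (simp add: cinner_matrix_add cinner_matrix_scaleR Re_cinner_self)
  qed
  then show thesis using K(1) by (intro that[of "1 / K"]) auto
qed

lemma psd_diag_nonneg:
  assumes "psd A" shows "0 \<le> Re (A $ i $ i)" "Im (A $ i $ i) = 0"
proof -
  have "0 \<le> Re (cinner (axis i 1) (A *v axis i 1))"
    using assms by (simp add: psd_def)
  then show "0 \<le> Re (A $ i $ i)"
    by (simp add: cinner_axis mult_axis_nth)
  show "Im (A $ i $ i) = 0"
    using assms hermitian_cnj[of A i i] by (simp add: psd_def complex_eq_iff)
qed

lemma psd_trace_real:
  assumes "psd A" shows "trace A = of_real (Re (trace A))" "0 \<le> Re (trace A)"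
proof -
  have "Im (trace A) = 0" using psd_diag_nonneg(2)[OF assms] by (simp add: trace_def)
  then show "trace A = of_real (Re (trace A))" by (simp add: complex_eq_iff)
  show "0 \<le> Re (trace A)" using psd_diag_nonneg(1)[OF assms] by (simp add: trace_def sum_nonneg)
qed

text \<open>Nonnegative diagonal entries with sum zero all vanish. Testing the form on a vector
  supported on \<open>i\<close> and \<open>j\<close> then leaves only a cross term linear in
  \<open>z\<close>, which cannot stay nonnegative for all \<open>z\<close> unless
  \<open>A $ i $ j = 0\<close>.\<close>

lemma psd_trace_zero:
  fixes A :: "('n::finite) op"
  assumes A: "psd A" and tr: "trace A = 0"
  shows "A = 0"
proof -
  have "(\<Sum>i\<in>UNIV. Re (A $ i $ i)) = 0"
    using tr by (simp add: trace_def complex_eq_iff)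
  then have "Re (A $ i $ i) = 0" for i
    using psd_diag_nonneg(1)[OF A] by (simp add: sum_nonneg_eq_0_iff)
  then have diag: "A $ i $ i = 0" for i
    using psd_diag_nonneg(2)[OF A, of i] by (simp add: complex_eq_iff)
  have "A $ i $ j = 0" if "i \<noteq> j" for i j
  proof -
    have pos: "0 \<le> Re (z * A $ i $ j)" for z
    proof -
      let ?v = "axis i 1 + axis j z :: complex ^ 'n"
      have v: "?v $ k = (if k = i then 1 else if k = j then z else 0)" for k
        using that by (simp add: axis_nth)
      have "0 \<le> Re (cinner ?v (A *v ?v))" using A by (simp add: psd_def)
      also have "cinner ?v (A *v ?v) =
          (\<Sum>k\<in>{i,j}. \<Sum>l\<in>{i,j}. cnj (?v $ k) * A $ k $ l * ?v $ l)"
        unfolding cinner_form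
        by (intro sum.mono_neutral_cong_right ballI sum.neutral) (auto simp: v simp del: vector_add_component)
      also have "\<dots> = A $ i $ j * z + cnj (A $ i $ j * z)"
        using that A diag unfolding v by (simp add: psd_def hermitian_cnj mult.commute)
      finally show ?thesis by (simp add: mult.commute)
    qed
    show ?thesis
      \<comment> \<open>The values 1 and -1 annihilate the real part of the entry, the two imaginary
        units its imaginary part.\<close>
      using pos[of 1] pos[of "-1"] pos[of \<i>] pos[of "-\<i>"] by (simp add: complex_eq_iff)
  qed
  with diag show ?thesis by (metis vec_eq_iff zero_index)
qed

section \<open>Orthonormal bases\<close>

lemma ketbra_mult: "ketbra u *v v = cinner u v *s u"
  by (simp add: vec_eq_iff ketbra_def matrix_vector_mult_def cinner_def sum_distrib_left
      sum_distrib_right mult_ac)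

text \<open>\<open>?U ** ?V\<close> is the Gram matrix of the family, hence the identity. A
  one-sided inverse of a square matrix is two-sided, and \<open>?V ** ?U\<close> is the sum of the
  projections.\<close>

lemma orthonormal_complete:
  fixes \<phi> :: "('n::finite) \<Rightarrow> complex ^ 'n"
  assumes "\<And>i j. cinner (\<phi> i) (\<phi> j) = (if i = j then 1 else 0)"
  shows "(\<Sum>i\<in>UNIV. ketbra (\<phi> i)) = mat 1"
proof -
  let ?U = "\<chi> i j. cnj (\<phi> i $ j)" and ?V = "\<chi> i j. \<phi> j $ i"
  have "?U ** ?V = mat 1"
    using assms by (simp add: matrix_matrix_mult_def mat_def cinner_def vec_eq_iff)
  then have "?V ** ?U = mat 1" by (simp add: matrix_left_right_inverse)
  moreover have "?V ** ?U = (\<Sum>i\<in>UNIV. ketbra (\<phi> i))"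
    by (simp add: matrix_matrix_mult_def ketbra_def vec_eq_iff)
  ultimately show ?thesis by simp
qed

text \<open>As many orthonormal vectors as the dimension span automatically: apply the resolution of
  the identity to \<open>v\<close>.\<close>

lemma orthonormal_basisI:
  fixes \<phi> :: "('n::finite) \<Rightarrow> complex ^ 'n"
  assumes "\<And>i j. cinner (\<phi> i) (\<phi> j) = (if i = j then 1 else 0)"
  shows "orthonormal_basis \<phi>"
proof -
  have "v \<in> vec.span (range \<phi>)" for v
  proof -
    have "v = (\<Sum>i\<in>UNIV. ketbra (\<phi> i)) *v v"
      using orthonormal_complete[of \<phi>, OF assms] by simp
    also have "\<dots> = (\<Sum>i\<in>UNIV. cinner (\<phi> i) v *s \<phi> i)"
    proof -
      have "(\<Sum>i\<in>UNIV. ketbra (\<phi> i)) *v v = (\<Sum>i\<in>UNIV. ketbra (\<phi> i) *v v)"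
        by (simp add: vec_eq_iff matrix_vector_mult_def sum_distrib_right) (intro allI sum.swap)
      then show ?thesis by (simp add: ketbra_mult)
    qed
    also have "\<dots> \<in> vec.span (range \<phi>)"
      by (intro vec.span_sum vec.span_scale vec.span_base) auto
    finally show ?thesis .
  qed
  then show ?thesis using assms by (auto simp: orthonormal_basis_def)
qed

lemma orthonormal_basis_axis: "orthonormal_basis (\<lambda>i. axis i 1)"
  by (rule orthonormal_basisI)
    (auto simp: cinner_axis axis_nth)

text \<open>Supplies a rank-one projection with a nonzero off-diagonal entry, which is needed to
  compare two diagonal entries of a matrix commuting with it.\<close>

lemma orthonormal_basis_rotated:
  assumes "a \<noteq> b"
  obtains \<phi> where "orthonormal_basis \<phi>" "\<phi> a = (1 / sqrt 2) *\<^sub>R (axis a 1 + axis b 1)"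
proof -
  let ?\<phi> = "\<lambda>i. if i = a then (1 / sqrt 2) *\<^sub>R (axis a 1 + axis b 1)
                else if i = b then (1 / sqrt 2) *\<^sub>R (axis a 1 - axis b 1) else axis i 1"
  have s: "complex_of_real (sqrt 2) * complex_of_real (sqrt 2) = 2"
    by (metis of_real_mult of_real_numeral real_sqrt_mult_self abs_numeral)
  have scale: "cinner (t *\<^sub>R u) v = of_real t * cinner u v" for t and u v :: "complex ^ 'a"
    by (simp add: cinner_def sum_distrib_left scaleR_conv_of_real[of t "_::complex"] mult_ac)
  have add: "cinner (u + w) v = cinner u v + cinner w v"
    and diff: "cinner (u - w) v = cinner u v - cinner w v" for u v w :: "complex ^ 'a"
    by (simp_all add: cinner_def algebra_simps sum.distrib sum_subtractf)
  have "orthonormal_basis ?\<phi>"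
  proof (rule orthonormal_basisI)
    fix i j
    show "cinner (?\<phi> i) (?\<phi> j) = (if i = j then 1 else 0)"
      using assms
      by (auto simp: scale add diff cinner_axis axis_nth s scaleR_conv_of_real[of _ "_::complex"] field_simps)
  qed
  then show thesis by (rule that) simp
qed

section \<open>Traces of tensor products and block decompositions of CQ states\<close>

lemma tensor_scaleR_right: "tensor_op A (t *\<^sub>R B) = t *\<^sub>R tensor_op A B"
  by (simp add: tensor_op_def vec_eq_iff)

lemma trace_scaleR: "trace (t *\<^sub>R A) = t *\<^sub>R trace (A :: ('n::finite) op)"
  by (simp add: trace_def scaleR_sum_right)

lemma trace_sum: "trace (\<Sum>i\<in>I. A i) = (\<Sum>i\<in>I. trace (A i :: ('n::finite) op))"
  by (simp add: trace_def) (rule sum.swap)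

lemma trace_tensor: "trace (tensor_op A B) = trace A * trace B"
  by (simp add: trace_def tensor_op_def sum_product sum.cartesian_product case_prod_unfold flip: UNIV_Times_UNIV)

lemma trace_ketbra: "trace (ketbra u) = cinner u u"
  by (simp add: trace_def ketbra_def cinner_def mult.commute)

text \<open>A decomposition into arbitrary positive blocks suffices: a block of weight zero vanishes, so
  that any state may be put in its place.\<close>

lemma is_CQ_iff:
  fixes \<rho> :: "('n::finite) bipartite_op"
  shows "is_CQ \<rho> \<longleftrightarrow>
    (\<exists>\<phi> B. orthonormal_basis \<phi> \<and> (\<forall>i. psd (B i)) \<and> trace \<rho> = 1 \<and>
       \<rho> = (\<Sum>i\<in>UNIV. tensor_op (ketbra (\<phi> i)) (B i)))"
proof
  assume "is_CQ \<rho>"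
  then obtain \<phi> \<eta> and c :: "'n \<Rightarrow> real" where 1: "orthonormal_basis \<phi>" "\<And>i. state (\<eta> i)"
    "\<And>i. 0 \<le> c i" "(\<Sum>i\<in>UNIV. c i) = 1"
    and \<rho>: "\<rho> = (\<Sum>i\<in>UNIV. c i *\<^sub>R tensor_op (ketbra (\<phi> i)) (\<eta> i))"
    unfolding is_CQ_def by blast
  have "trace \<rho> = (\<Sum>i\<in>UNIV. of_real (c i))"
    using 1 unfolding \<rho> trace_sum trace_scaleR trace_tensor
    by (simp add: trace_ketbra state_def orthonormal_basis_def scaleR_conv_of_real)
  also have "\<dots> = 1" using 1(4) by (metis of_real_1 of_real_sum)
  finally have "trace \<rho> = 1" .
  moreover have "psd (c i *\<^sub>R \<eta> i)" for i
    using 1 by (simp add: state_def psd_scaleR)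
  ultimately show "\<exists>\<phi> B. orthonormal_basis \<phi> \<and> (\<forall>i. psd (B i)) \<and> trace \<rho> = 1 \<and>
       \<rho> = (\<Sum>i\<in>UNIV. tensor_op (ketbra (\<phi> i)) (B i))"
    using 1(1) \<rho> by (intro exI[of _ \<phi>] exI[of _ "\<lambda>i. c i *\<^sub>R \<eta> i"]) (simp add: tensor_scaleR_right)
next
  assume "\<exists>\<phi> B. orthonormal_basis \<phi> \<and> (\<forall>i. psd (B i)) \<and> trace \<rho> = 1 \<and>
       \<rho> = (\<Sum>i\<in>UNIV. tensor_op (ketbra (\<phi> i)) (B i))"
  then obtain \<phi> B where onb: "orthonormal_basis \<phi>" and B: "\<And>i. psd (B i)" and tr: "trace \<rho> = 1"
    and \<rho>: "\<rho> = (\<Sum>i\<in>UNIV. tensor_op (ketbra (\<phi> i)) (B i))" by blast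
  define c where "c i = Re (trace (B i))" for i
  define \<eta> where "\<eta> i = (if c i = 0 then ketbra (axis i 1) else (1 / c i) *\<^sub>R B i)" for i
  have c: "0 \<le> c i" "trace (B i) = of_real (c i)" for i
    using psd_trace_real[OF B] by (simp_all add: c_def)
  have B0: "B i = 0" if "c i = 0" for i
    using psd_trace_zero[OF B] c(2) that by simp
  have "state (\<eta> i)" for i
    using c[of i] by (auto simp: state_def \<eta>_def psd_ketbra B psd_scaleR trace_scaleR trace_ketbra
        cinner_axis axis_nth scaleR_conv_of_real[of _ "_::complex"])
  moreover have "c i *\<^sub>R \<eta> i = B i" for i
    using B0 by (simp add: \<eta>_def)
  moreover have "(\<Sum>i\<in>UNIV. c i) = 1"
  proof -
    have "1 = (\<Sum>i\<in>UNIV. complex_of_real (c i))"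
      using tr onb unfolding \<rho> trace_sum trace_tensor
      by (simp add: c trace_ketbra orthonormal_basis_def)
    then show ?thesis by (metis of_real_1 of_real_eq_iff of_real_sum)
  qed
  ultimately show "is_CQ \<rho>"
    using onb c(1) \<rho> unfolding is_CQ_def
    by (intro exI[of _ \<phi>] exI[of _ \<eta>] exI[of _ c]) (simp flip: tensor_scaleR_right)
qed

section \<open>Blocks over the second factor and their commutation\<close>

definition block :: "('n::finite) bipartite_op \<Rightarrow> 'n \<Rightarrow> 'n \<Rightarrow> 'n op" where
  "block \<rho> k l = (\<chi> x y. \<rho> $ (x, k) $ (y, l))"

text \<open>Each block is \<Sum> over \<open>i\<close> of the number \<open>B i $ k $ l\<close>
  times the projection \<open>ketbra (\<phi> i)\<close>, so all blocks are diagonal in the one basis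
  \<open>\<phi>\<close>.\<close>

lemma is_CQ_blocks_commute:
  fixes \<rho> :: "('n::finite) bipartite_op"
  assumes "is_CQ \<rho>"
  shows "block \<rho> k l ** block \<rho> k' l' = block \<rho> k' l' ** block \<rho> k l"
proof -
  obtain \<phi> B where onb: "orthonormal_basis \<phi>"
    and \<rho>: "\<rho> = (\<Sum>i\<in>UNIV. tensor_op (ketbra (\<phi> i)) (B i))"
    using assms unfolding is_CQ_iff by blast
  \<comment> \<open>By orthonormality the product is again diagonal in \<open>\<phi>\<close>; its
    coefficients are products of numbers and hence symmetric in the two index pairs.\<close>
  have prod: "(block \<rho> k l ** block \<rho> k' l') $ x $ y =
      (\<Sum>i\<in>UNIV. \<phi> i $ x * cnj (\<phi> i $ y) * (B i $ k $ l * B i $ k' $ l'))" for k l k' l' x y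
  proof -
    have "(block \<rho> k l ** block \<rho> k' l') $ x $ y =
        (\<Sum>z\<in>UNIV. \<Sum>i\<in>UNIV. \<Sum>j\<in>UNIV. \<phi> i $ x * cnj (\<phi> j $ y) * (B i $ k $ l * B j $ k' $ l') *
           (cnj (\<phi> i $ z) * \<phi> j $ z))"
      by (simp add: matrix_matrix_mult_def block_def \<rho> tensor_op_def ketbra_def sum_product mult_ac)
    also have "\<dots> = (\<Sum>i\<in>UNIV. \<Sum>z\<in>UNIV. \<Sum>j\<in>UNIV. \<phi> i $ x * cnj (\<phi> j $ y) * (B i $ k $ l * B j $ k' $ l') *
           (cnj (\<phi> i $ z) * \<phi> j $ z))"
      by (rule sum.swap)
    also have "\<dots> = (\<Sum>i\<in>UNIV. \<Sum>j\<in>UNIV. \<Sum>z\<in>UNIV. \<phi> i $ x * cnj (\<phi> j $ y) * (B i $ k $ l * B j $ k' $ l') *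
           (cnj (\<phi> i $ z) * \<phi> j $ z))"
      by (intro sum.cong refl sum.swap)
    also have "\<dots> = (\<Sum>i\<in>UNIV. \<Sum>j\<in>UNIV. \<phi> i $ x * cnj (\<phi> j $ y) * (B i $ k $ l * B j $ k' $ l') *
           cinner (\<phi> i) (\<phi> j))"
      by (simp add: cinner_def sum_distrib_left)
    also have "\<dots> = (\<Sum>i\<in>UNIV. \<Sum>j\<in>UNIV.
        if i = j then \<phi> i $ x * cnj (\<phi> j $ y) * (B i $ k $ l * B j $ k' $ l') else 0)"
      using onb by (intro sum.cong refl) (simp add: orthonormal_basis_def)
    finally show ?thesis by simp
  qed
  show ?thesis
    by (simp add: vec_eq_iff prod mult.commute)
qed

text \<open>Commuting with the coordinate projections makes \<open>D\<close> diagonal; commuting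
  with the projection onto the normalised sum of two axis vectors makes the two corresponding
  diagonal entries equal.\<close>

lemma scalar_if_commutes_with_bases:
  fixes D :: "('n::finite) op"
  assumes "\<And>\<phi> i. orthonormal_basis \<phi> \<Longrightarrow> D ** ketbra (\<phi> i) = ketbra (\<phi> i) ** D"
  shows "D $ i $ j = (if i = j then D $ a $ a else 0)"
proof -
  have off: "D $ i $ j = 0" if "i \<noteq> j" for i j
  proof -
    have "(D ** ketbra (axis j 1)) $ i $ j = (ketbra (axis j 1) ** D) $ i $ j"
      using assms[OF orthonormal_basis_axis] by simp
    then show ?thesis
      using that by (simp add: matrix_matrix_mult_def ketbra_def axis_nth if_distrib[of cnj]
          if_distrib[of "\<lambda>x. x * _"] if_distrib[of "\<lambda>x. _ * x"] cong: if_cong)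
  qed
  have "D $ i $ i = D $ a $ a" if ia: "i \<noteq> a"
  proof -
    obtain \<phi> :: "'n \<Rightarrow> complex ^ 'n" where \<phi>: "orthonormal_basis \<phi>"
      "\<phi> i = (1 / sqrt 2) *\<^sub>R (axis i 1 + axis a 1)"
      using orthonormal_basis_rotated[OF ia] .
    let ?P = "ketbra (\<phi> i)"
    have P: "?P $ i $ a = 1 / 2"
    proof -
      have "complex_of_real (sqrt 2) * complex_of_real (sqrt 2) = 2"
        by (metis of_real_mult of_real_numeral real_sqrt_mult_self abs_numeral)
      then show ?thesis
        using that by (simp add: ketbra_def \<phi>(2) axis_nth scaleR_conv_of_real[of _ "_::complex"])
    qed
    \<comment> \<open>As \<open>D\<close> is diagonal, entry \<open>(i, a)\<close> of the
      commutation relation reads \<open>D $ i $ i / 2 = D $ a $ a / 2\<close>.\<close>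
    have "(D ** ?P) $ i $ a = (\<Sum>z\<in>UNIV. if z = i then D $ i $ i * ?P $ i $ a else 0)"
      unfolding matrix_matrix_mult_def vec_lambda_beta by (intro sum.cong) (auto simp: off)
    moreover have "(?P ** D) $ i $ a = (\<Sum>z\<in>UNIV. if z = a then ?P $ i $ a * D $ a $ a else 0)"
      unfolding matrix_matrix_mult_def vec_lambda_beta by (intro sum.cong) (auto simp: off)
    ultimately show ?thesis
      using assms[OF \<phi>(1), of i] P by simp
  qed
  then show ?thesis using off by auto
qed

section \<open>Product vectors and CQ states shifted by 1 \<otimes> B\<close>

lemma tensor_add_right: "tensor_op A (B + C) = tensor_op A B + tensor_op A C"
  by (simp add: tensor_op_def vec_eq_iff algebra_simps)

lemma tensor_zero_right: "tensor_op A 0 = 0"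
  by (simp add: tensor_op_def vec_eq_iff)

lemma tensor_sum_left: "tensor_op (\<Sum>i\<in>I. A i) B = (\<Sum>i\<in>I. tensor_op (A i) B)"
  by (simp add: tensor_op_def vec_eq_iff sum_distrib_right)

lemma tensor_mat_1: "tensor_op (mat 1) (mat 1) = mat 1"
  by (auto simp: tensor_op_def vec_eq_iff mat_def prod_eq_iff)

lemma hermitian_tensor: "hermitian A \<Longrightarrow> hermitian B \<Longrightarrow> hermitian (tensor_op A B)"
  by (rule hermitianI) (simp add: tensor_op_def hermitian_cnj)

definition vtensor :: "complex ^ 'n \<Rightarrow> complex ^ 'n \<Rightarrow> complex ^ ('n::finite \<times> 'n)" where
  "vtensor u w = (\<chi> p. u $ fst p * w $ snd p)"

lemma sum_UNIV_pairs: "(\<Sum>p\<in>UNIV. f (fst p) (snd p)) = (\<Sum>x\<in>UNIV. \<Sum>y\<in>UNIV. f x y)"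
  by (simp add: sum.cartesian_product case_prod_unfold flip: UNIV_Times_UNIV)

lemma cinner_vtensor: "cinner (vtensor u w) (vtensor u' w') = cinner u u' * cinner w w'"
proof -
  have "cinner (vtensor u w) (vtensor u' w') =
      (\<Sum>p\<in>UNIV. (cnj (u $ fst p) * u' $ fst p) * (cnj (w $ snd p) * w' $ snd p))"
    by (simp add: cinner_def vtensor_def mult_ac)
  also have "\<dots> = cinner u u' * cinner w w'"
    unfolding cinner_def sum_product by (rule sum_UNIV_pairs)
  finally show ?thesis .
qed

lemma tensor_vtensor: "tensor_op A B *v vtensor u w = vtensor (A *v u) (B *v w)"
proof -
  have "(tensor_op A B *v vtensor u w) $ p =
      (\<Sum>q\<in>UNIV. (A $ fst p $ fst q * u $ fst q) * (B $ snd p $ snd q * w $ snd q))" for p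
    by (simp add: matrix_vector_mult_def tensor_op_def vtensor_def mult_ac)
  also have "\<dots> p = vtensor (A *v u) (B *v w) $ p" for p
    using sum_UNIV_pairs[of "\<lambda>x y. (A $ fst p $ x * u $ x) * (B $ snd p $ y * w $ y)"]
    by (simp add: vtensor_def matrix_vector_mult_def sum_product)
  finally show ?thesis by (simp only: vec_eq_iff) simp
qed

lemma tensor_ketbra: "tensor_op (ketbra u) (ketbra w) = ketbra (vtensor u w)"
  by (simp add: vec_eq_iff tensor_op_def ketbra_def vtensor_def mult_ac)

lemma cinner_matrix_sum:
  "cinner v ((\<Sum>i\<in>I. A i) *v v) = (\<Sum>i\<in>I. cinner v (A i *v v))"
proof (induction I rule: infinite_finite_induct)
  case (insert i I)
  then show ?case by (simp add: cinner_matrix_add)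
qed (simp_all add: cinner_def)

lemma cinner_scale_right: "cinner u (z *s v) = z * cinner u v"
  by (simp add: cinner_def sum_distrib_left mult_ac)

text \<open>The blocks change from \<open>A i\<close> to \<open>A i + B\<close>. Since
  \<open>B\<close> may be indefinite, their positivity comes from that of the whole shifted state,
  tested on the product vectors \<open>vtensor (\<phi> i) v\<close>, which see block
  \<open>i\<close> only.\<close>

lemma is_CQ_add_local:
  fixes \<rho> :: "('n::finite) bipartite_op"
  assumes "is_CQ \<rho>" and herm: "hermitian B" and state: "state (\<rho> + tensor_op (mat 1) B)"
  shows "is_CQ (\<rho> + tensor_op (mat 1) B)"
proof -
  obtain \<phi> A where onb: "orthonormal_basis \<phi>" and A: "\<And>i. psd (A i)"
    and \<rho>: "\<rho> = (\<Sum>i\<in>UNIV. tensor_op (ketbra (\<phi> i)) (A i))"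
    using assms(1) unfolding is_CQ_iff by blast
  have orth: "cinner (\<phi> i) (\<phi> j) = (if i = j then 1 else 0)" for i j
    using onb by (simp add: orthonormal_basis_def)
  have eq: "\<rho> + tensor_op (mat 1) B = (\<Sum>i\<in>UNIV. tensor_op (ketbra (\<phi> i)) (A i + B))"
    unfolding \<rho> orthonormal_complete[of \<phi>, OF orth, symmetric] tensor_sum_left
    by (simp add: tensor_add_right sum.distrib)
  have "psd (A i + B)" for i
    unfolding psd_def
  proof (intro conjI allI)
    show "hermitian (A i + B)" using A herm by (simp add: psd_def hermitian_add)
    fix v
    let ?w = "vtensor (\<phi> i) v"
    have "0 \<le> Re (cinner ?w ((\<rho> + tensor_op (mat 1) B) *v ?w))"
      using state by (simp add: state_def psd_def)
    also have "cinner ?w ((\<rho> + tensor_op (mat 1) B) *v ?w) =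
        (\<Sum>j\<in>UNIV. if j = i then cinner v ((A j + B) *v v) else 0)"
      unfolding eq cinner_matrix_sum tensor_vtensor cinner_vtensor ketbra_mult cinner_scale_right orth
      by (intro sum.cong) auto
    finally show "0 \<le> Re (cinner v ((A i + B) *v v))" by simp
  qed
  then show ?thesis
    unfolding is_CQ_iff using onb state eq
    by (intro exI[of _ \<phi>] exI[of _ "\<lambda>i. A i + B"]) (simp add: state_def)
qed

section \<open>Undetected operators of POVMs that determine CQ\<close>

lemma matrix_scaleR_left: "(t *\<^sub>R A) ** B = t *\<^sub>R (A ** (B :: ('n::finite) op))"
  by (simp add: vec_eq_iff matrix_matrix_mult_def scaleR_sum_right)

lemma matrix_scaleR_right: "A ** (t *\<^sub>R B) = t *\<^sub>R (A ** (B :: ('n::finite) op))"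
  by (simp add: vec_eq_iff matrix_matrix_mult_def scaleR_sum_right)

lemma matrix_add_rdistrib: "(A + B) ** C = A ** C + B ** (C :: ('n::finite) op)"
  by (simp add: vec_eq_iff matrix_matrix_mult_def algebra_simps sum.distrib)

text \<open>Conjugating the trace amounts to exchanging the two summation indices, so it is real.
  This turns the trace pairing into the real Euclidean inner product, and undetected operators into
  an orthogonal complement.\<close>

lemma trace_mult_inner:
  assumes "hermitian A" "hermitian B"
  shows "trace (A ** B) = of_real (A \<bullet> B)"
proof -
  have tr: "trace (A ** B) = (\<Sum>i\<in>UNIV. \<Sum>j\<in>UNIV. A $ i $ j * cnj (B $ i $ j))"
    by (simp add: trace_def matrix_matrix_mult_def hermitian_cnj[OF assms(2)])
  have "cnj (trace (A ** B)) = (\<Sum>i\<in>UNIV. \<Sum>j\<in>UNIV. A $ j $ i * cnj (B $ j $ i))"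
    unfolding tr cnj_sum by (simp add: hermitian_cnj assms)
  also have "\<dots> = trace (A ** B)"
    unfolding tr by (rule sum.swap)
  finally have "Im (trace (A ** B)) = 0" by (simp add: complex_eq_iff)
  moreover have "Re (trace (A ** B)) = A \<bullet> B"
    unfolding tr by (simp add: inner_vec_def inner_complex_def)
  ultimately show ?thesis by (simp add: complex_eq_iff)
qed

lemma undetected_eq_orthogonal:
  assumes "\<And>j. j < m \<Longrightarrow> hermitian (E j)"
  shows "undetected m E = {\<Delta>. hermitian \<Delta> \<and> (\<forall>j<m. orthogonal (E j) \<Delta>)}"
  using assms by (auto simp: undetected_def trace_mult_inner orthogonal_def inner_commute)

text \<open>The effects sum to the identity, so an undetected operator is orthogonal to
  \<open>mat 1\<close>.\<close>

lemma trace_undetected: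
  assumes "povm m E" "\<Delta> \<in> undetected m E"
  shows "trace \<Delta> = 0"
proof -
  have herm: "\<And>j. j < m \<Longrightarrow> hermitian (E j)" and one: "(\<Sum>j<m. E j) = mat 1"
    using assms(1) by (auto simp: povm_def psd_def)
  have \<Delta>: "hermitian \<Delta>" "\<And>j. j < m \<Longrightarrow> orthogonal (E j) \<Delta>"
    using assms(2) undetected_eq_orthogonal[of m E] herm by auto
  have "trace \<Delta> = trace (\<Delta> ** mat 1)" by simp
  also have "\<dots> = of_real (\<Delta> \<bullet> (\<Sum>j<m. E j))"
    unfolding one by (intro trace_mult_inner \<Delta> hermitian_mat_1)
  also have "\<dots> = 0"
    using \<Delta> by (simp add: inner_sum_right orthogonal_def inner_commute)
  finally show ?thesis .
qed

text \<open>\<open>S\<close> stands for a block of the identity, so it commutes with everything. The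
  terms of order zero cancel, and what remains can be divided by \<open>t\<close>.\<close>

lemma commutator_perturb:
  fixes D D' P S :: "('n::finite) op"
  assumes "S = 0 \<or> S = mat 1" "t \<noteq> 0"
    and "(S + t *\<^sub>R D) ** (mat 1 + P + t *\<^sub>R D') = (mat 1 + P + t *\<^sub>R D') ** (S + t *\<^sub>R D)"
  shows "D ** P + t *\<^sub>R (D ** D') = P ** D + t *\<^sub>R (D' ** D)"
proof -
  have "t *\<^sub>R (D ** P + t *\<^sub>R (D ** D')) = t *\<^sub>R (P ** D + t *\<^sub>R (D' ** D))"
    using assms(1,3)
    by (auto simp: matrix_add_ldistrib matrix_add_rdistrib matrix_scaleR_left matrix_scaleR_right
        scaleR_add_right)
  then show ?thesis using assms(2) by simp
qed

text \<open>Perturb the CQ state proportional to \<open>1 + P \<otimes> |e\<^sub>m\<rangle>\<langle>e\<^sub>m|\<close> by \<open>\<plusminus>\<Delta>\<close>: its blocks must still commute.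
  Averaging over the two signs removes the second-order term, so every block of \<open>\<Delta>\<close> commutes with
  \<open>P\<close>. As \<open>d \<ge> 2\<close>, the index \<open>m\<close> can be chosen different from the row index of the block.\<close>

lemma undetected_block_commutes:
  fixes E :: "nat \<Rightarrow> ('n::finite) bipartite_op"
  assumes povm: "povm m E" and det: "determines m E is_CQ" and card: "2 \<le> CARD('n)"
    and \<Delta>: "\<Delta> \<in> undetected m E" and onb: "orthonormal_basis \<phi>"
  shows "block \<Delta> k l ** ketbra (\<phi> i) = ketbra (\<phi> i) ** block \<Delta> k l"
proof -
  have orth: "cinner (\<phi> i) (\<phi> j) = (if i = j then 1 else 0)" for i j
    using onb by (simp add: orthonormal_basis_def)
  have "\<exists>n. n \<noteq> k"
  proof (rule ccontr)
    assume "\<nexists>n. n \<noteq> k"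
    then have "UNIV = {k}" by auto
    then have "CARD('n) = card {k}" by (rule arg_cong)
    then show False using card by simp
  qed
  then obtain n where n: "n \<noteq> k" ..
  have herm: "hermitian \<Delta>" using \<Delta> by (simp add: undetected_def)
  obtain e where e: "e > 0" "\<And>t. \<bar>t\<bar> \<le> e \<Longrightarrow> psd (mat 1 + t *\<^sub>R \<Delta>)"
    using psd_perturb_identity[OF herm] by blast
  let ?P = "ketbra (\<phi> i)" and ?M = "ketbra (axis n 1 :: complex ^ 'n)"
  \<comment> \<open>The normalisation: the trace of the identity plus a rank-one projection is
    \<open>d\<^sup>2 + 1\<close>, and adding a multiple of the traceless \<open>\<Delta>\<close>
    does not change it.\<close>
  define c :: real where "c = 1 / (real CARD('n) * real CARD('n) + 1)"
  have pos: "real CARD('n) * real CARD('n) + 1 > 0" by (simp add: add_nonneg_pos)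
  then have c: "c > 0" by (simp add: c_def)
  define \<rho> where "\<rho> t = c *\<^sub>R ((mat 1 + t *\<^sub>R \<Delta>) + tensor_op ?P ?M)" for t
  have "complex_of_real c * (of_nat CARD('n) * of_nat CARD('n) + 1) =
      of_real (c * (real CARD('n) * real CARD('n) + 1))" by simp
  also have "\<dots> = 1" using pos by (simp add: c_def)
  finally have cN: "complex_of_real c * (of_nat CARD('n) * of_nat CARD('n) + 1) = 1" .
  have "trace (\<rho> t) = 1" for t
    using trace_undetected[OF povm \<Delta>] cN
    by (simp add: \<rho>_def trace_scaleR trace_add trace_tensor trace_ketbra orth cinner_axis axis_nth
        trace_I scaleR_conv_of_real[of _ "_::complex"])
  then have state: "state (\<rho> t)" if "\<bar>t\<bar> \<le> e" for t
    using e(2)[OF that] c by (simp add: state_def \<rho>_def psd_scaleR psd_add tensor_ketbra psd_ketbra)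
  have CQ0: "is_CQ (\<rho> 0)"
    unfolding is_CQ_iff
  proof (intro exI conjI allI)
    let ?B = "\<lambda>j. c *\<^sub>R (mat 1 + (if j = i then ?M else 0))"
    show "orthonormal_basis \<phi>" by (rule onb)
    show "psd (?B j)" for j
      using c by (auto intro!: psd_scaleR psd_add psd_mat_1 psd_ketbra psd_zero)
    show "trace (\<rho> 0) = 1" by fact
    have "(\<Sum>j\<in>UNIV. tensor_op (ketbra (\<phi> j)) (?B j)) =
        c *\<^sub>R (tensor_op (\<Sum>j\<in>UNIV. ketbra (\<phi> j)) (mat 1) +
          (\<Sum>j\<in>UNIV. if j = i then tensor_op (ketbra (\<phi> j)) ?M else 0))"
      unfolding tensor_sum_left tensor_scaleR_right tensor_add_right sum.distrib[symmetric] scaleR_sum_right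
      by (intro sum.cong) (auto simp: tensor_zero_right)
    also have "\<dots> = \<rho> 0"
      by (simp add: orthonormal_complete[of \<phi>, OF orth] tensor_mat_1 \<rho>_def)
    finally show "\<rho> 0 = (\<Sum>j\<in>UNIV. tensor_op (ketbra (\<phi> j)) (?B j))" ..
  qed
  have split: "\<rho> t = \<rho> 0 + (c * t) *\<^sub>R \<Delta>" for t
    by (simp add: \<rho>_def scaleR_add_right)
  \<comment> \<open>\<open>\<rho> 0\<close> and \<open>\<rho> t\<close> differ by an undetected
    operator, so the outcomes cannot separate them and \<open>\<rho> t\<close> inherits the CQ
    property.\<close>
  have "trace (\<rho> 0 ** E j) = trace (\<rho> t ** E j)" if "j < m" for t j
    using \<Delta> that unfolding split[of t]
    by (simp add: matrix_add_rdistrib trace_add matrix_scaleR_left trace_scaleR undetected_def)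
  then have CQ: "is_CQ (\<rho> t)" if "\<bar>t\<bar> \<le> e" for t
    using det CQ0 state[OF that] state[of 0] e(1) unfolding determines_def by (metis abs_zero less_imp_le)
  let ?D = "block \<Delta> k l" and ?D' = "block \<Delta> n n"
  have comm: "?D ** ?P + t *\<^sub>R (?D ** ?D') = ?P ** ?D + t *\<^sub>R (?D' ** ?D)" if "\<bar>t\<bar> \<le> e" "t \<noteq> 0" for t
  proof (rule commutator_perturb)
    let ?S = "if k = l then mat 1 else 0 :: 'n op"
    show "?S = 0 \<or> ?S = mat 1" by simp
    show "t \<noteq> 0" by fact
    \<comment> \<open>Because \<open>n \<noteq> k\<close>, the rank-one term is absent from this
      block; in block \<open>(n, n)\<close> below it contributes exactly \<open>?P\<close>.\<close>
    have b1: "block (\<rho> t) k l = c *\<^sub>R (?S + t *\<^sub>R ?D)"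
      using n by (auto simp: vec_eq_iff block_def \<rho>_def tensor_op_def mat_def ketbra_def axis_nth)
    have b2: "block (\<rho> t) n n = c *\<^sub>R (mat 1 + ?P + t *\<^sub>R ?D')"
      by (auto simp: vec_eq_iff block_def \<rho>_def tensor_op_def mat_def ketbra_def axis_nth)
    have "block (\<rho> t) k l ** block (\<rho> t) n n = block (\<rho> t) n n ** block (\<rho> t) k l"
      by (rule is_CQ_blocks_commute[OF CQ[OF that(1)]])
    then show "(?S + t *\<^sub>R ?D) ** (mat 1 + ?P + t *\<^sub>R ?D') = (mat 1 + ?P + t *\<^sub>R ?D') ** (?S + t *\<^sub>R ?D)"
      unfolding b1 b2 matrix_scaleR_left matrix_scaleR_right using c by simp
  qed
  have "2 *\<^sub>R (?D ** ?P) = (?D ** ?P + e *\<^sub>R (?D ** ?D')) + (?D ** ?P + (-e) *\<^sub>R (?D ** ?D'))"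
    by (simp add: scaleR_2)
  also have "\<dots> = (?P ** ?D + e *\<^sub>R (?D' ** ?D)) + (?P ** ?D + (-e) *\<^sub>R (?D' ** ?D))"
    using comm[of e] comm[of "-e"] e(1) by simp
  also have "\<dots> = 2 *\<^sub>R (?P ** ?D)"
    by (simp add: scaleR_2)
  finally show ?thesis by simp
qed

text \<open>The trace condition is included because undetected operators are traceless; it accounts
  for the -1 in the dimension \<open>d\<^sup>2 - 1\<close>.\<close>

definition local_traceless :: "('n::finite) bipartite_op set" where
  "local_traceless = tensor_op (mat 1) ` {B. hermitian B \<and> trace B = 0}"

text \<open>Every block of \<open>\<Delta>\<close> commutes with all rank-one projections of
  orthonormal bases and is therefore scalar; these scalars are the entries of
  \<open>B\<close>.\<close>

lemma undetected_subset_local_traceless: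
  fixes E :: "nat \<Rightarrow> ('n::finite) bipartite_op"
  assumes povm: "povm m E" and det: "determines m E is_CQ" and card: "2 \<le> CARD('n)"
  shows "undetected m E \<subseteq> local_traceless"
proof
  fix \<Delta> assume \<Delta>: "\<Delta> \<in> undetected m E"
  \<comment> \<open>An arbitrary reference index: the scalar in each block is read off at its
    diagonal position \<open>a\<close>.\<close>
  obtain a :: 'n where True by blast
  define B where "B = (\<chi> k l. \<Delta> $ (a, k) $ (a, l))"
  have scalar: "block \<Delta> k l $ i $ j = (if i = j then block \<Delta> k l $ a $ a else 0)" for k l i j
    by (rule scalar_if_commutes_with_bases) (rule undetected_block_commutes[OF assms \<Delta>])
  have "\<Delta> $ p $ q = tensor_op (mat 1) B $ p $ q" for p q
    using scalar[of "snd p" "snd q" "fst p" "fst q"]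
    unfolding block_def B_def tensor_op_def mat_def vec_lambda_beta prod.collapse by simp
  then have eq: "\<Delta> = tensor_op (mat 1) B"
    unfolding vec_eq_iff by blast
  have "hermitian \<Delta>" using \<Delta> by (simp add: undetected_def)
  then have "hermitian B" by (intro hermitianI) (simp add: B_def hermitian_cnj)
  moreover have "trace B = 0"
    using trace_undetected[OF povm \<Delta>] unfolding eq by (simp add: trace_tensor trace_I)
  ultimately show "\<Delta> \<in> local_traceless" using eq by (auto simp: local_traceless_def)
qed

text \<open>Two states with equal outcome probabilities differ by an undetected operator, here a
  local one, and such a shift preserves CQ.\<close>

lemma determines_CQ_if_undetected_local:
  fixes E :: "nat \<Rightarrow> ('n::finite) bipartite_op"
  assumes "undetected m E \<subseteq> local_traceless"
  shows "determines m E is_CQ"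
  unfolding determines_def
proof safe
  fix \<rho>\<^sub>1 \<rho>\<^sub>2 :: "'n bipartite_op"
  assume st: "state \<rho>\<^sub>1" "is_CQ \<rho>\<^sub>1" "state \<rho>\<^sub>2" "\<not> is_CQ \<rho>\<^sub>2"
    and eq: "\<forall>j<m. trace (\<rho>\<^sub>1 ** E j) = trace (\<rho>\<^sub>2 ** E j)"
  have "(\<rho>\<^sub>2 - \<rho>\<^sub>1) ** E j = \<rho>\<^sub>2 ** E j - \<rho>\<^sub>1 ** E j" for j
    by (simp add: vec_eq_iff matrix_matrix_mult_def algebra_simps sum_subtractf)
  then have "\<rho>\<^sub>2 - \<rho>\<^sub>1 \<in> undetected m E"
    using st eq by (simp add: undetected_def state_def psd_def hermitian_diff trace_sub)
  then obtain B where B: "hermitian B" "\<rho>\<^sub>2 - \<rho>\<^sub>1 = tensor_op (mat 1) B"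
    using assms by (auto simp: local_traceless_def)
  then have "\<rho>\<^sub>2 = \<rho>\<^sub>1 + tensor_op (mat 1) B" by (metis add.commute diff_add_cancel)
  then show False using is_CQ_add_local[OF st(2) B(1)] st by simp
qed

section \<open>Real dimensions of spaces of Hermitian operators\<close>

lemma inner_op: "A \<bullet> B = Re (\<Sum>i\<in>UNIV. \<Sum>j\<in>UNIV. A $ i $ j * cnj (B $ i $ j :: complex))"
  by (simp add: inner_vec_def inner_complex_def)

text \<open>Let \<open>X'\<close> be the adjoint of \<open>X\<close>. The Hermitian matrix
  \<open>X + X'\<close> has the same inner product with \<open>X\<close> and with \<open>X'\<close>,
  namely zero, so it is orthogonal to itself and vanishes.\<close>

lemma skew_hermitian_if_orthogonal:
  fixes X :: "('n::finite) op"
  assumes "\<And>A. hermitian A \<Longrightarrow> A \<bullet> X = 0"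
  shows "cnj (X $ i $ j) = - X $ j $ i"
proof -
  define X' :: "'n op" where "X' = (\<chi> i j. cnj (X $ j $ i))"
  let ?Y = "X + X'"
  have Y: "hermitian ?Y" by (rule hermitianI) (simp add: X'_def)
  have "?Y \<bullet> X' = Re (\<Sum>i\<in>UNIV. \<Sum>j\<in>UNIV. ?Y $ i $ j * X $ j $ i)"
    unfolding inner_op by (simp add: X'_def)
  also have "(\<Sum>i\<in>UNIV. \<Sum>j\<in>UNIV. ?Y $ i $ j * X $ j $ i) = (\<Sum>j\<in>UNIV. \<Sum>i\<in>UNIV. ?Y $ i $ j * X $ j $ i)"
    by (rule sum.swap)
  also have "\<dots> = cnj (\<Sum>j\<in>UNIV. \<Sum>i\<in>UNIV. ?Y $ j $ i * cnj (X $ j $ i))"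
    unfolding cnj_sum complex_cnj_mult complex_cnj_cnj hermitian_cnj[OF Y] ..
  also have "Re \<dots> = ?Y \<bullet> X" unfolding inner_op cnj.simps(1) ..
  finally have "?Y \<bullet> ?Y = 0" using assms[OF Y] by (simp add: inner_add_right)
  then have "?Y $ j $ i = 0" by simp
  then show ?thesis by (simp add: X'_def eq_neg_iff_add_eq_0 add.commute)
qed

text \<open>Multiplication by the imaginary unit maps the Hermitian matrices isomorphically onto
  their orthogonal complement, so they make up half of the real dimension
  \<open>2 * CARD('n)\<^sup>2\<close>.\<close>

lemma dim_hermitian: "dim {A :: ('n::finite) op. hermitian A} = CARD('n)\<^sup>2"
proof -
  let ?H = "{A :: 'n op. hermitian A}"
  let ?f = "\<lambda>A :: 'n op. (\<chi> i j. \<i> * A $ i $ j) :: 'n op"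
  have "{X \<in> UNIV. \<forall>A\<in>?H. orthogonal A X} = ?f ` ?H"
  proof (intro set_eqI iffI)
    fix X assume "X \<in> {X \<in> UNIV. \<forall>A\<in>?H. orthogonal A X}"
    then have skew: "cnj (X $ i $ j) = - X $ j $ i" for i j
      using skew_hermitian_if_orthogonal[of X] by (simp add: orthogonal_def)
    have "hermitian (\<chi> i j. - \<i> * X $ i $ j)"
      by (rule hermitianI) (simp add: skew)
    moreover have "X = ?f (\<chi> i j. - \<i> * X $ i $ j)" by (simp add: vec_eq_iff)
    ultimately show "X \<in> ?f ` ?H" by blast
  next
    fix X assume "X \<in> ?f ` ?H"
    then obtain B where B: "hermitian B" "X = ?f B" by blast
    have "A \<bullet> X = 0" if A: "hermitian A" for A
    proof -
      have "A \<bullet> X = Re (- \<i> * (\<Sum>i\<in>UNIV. \<Sum>j\<in>UNIV. A $ i $ j * cnj (B $ i $ j)))"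
        unfolding inner_op B(2) sum_distrib_left by (simp add: mult_ac)
      also have "(\<Sum>i\<in>UNIV. \<Sum>j\<in>UNIV. A $ i $ j * cnj (B $ i $ j)) = trace (A ** B)"
        by (simp add: trace_def matrix_matrix_mult_def hermitian_cnj[OF B(1)])
      finally show ?thesis by (simp add: trace_mult_inner[OF A B(1)])
    qed
    then show "X \<in> {X \<in> UNIV. \<forall>A\<in>?H. orthogonal A X}" by (simp add: orthogonal_def)
  qed
  moreover have "linear ?f"
    by (rule linearI) (simp_all add: vec_eq_iff algebra_simps)
  then have "dim (?f ` ?H) = dim ?H"
    by (rule dim_image_eq) (auto simp: inj_on_def vec_eq_iff)
  ultimately have "dim ?H + dim ?H = DIM('n op)"
    using dim_subspace_orthogonal_to_vectors[OF subspace_hermitian[where 'a='n] subspace_UNIV] by simp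
  then show ?thesis by (simp add: power2_eq_square)
qed

lemma subspace_orthogonal_in:
  assumes "subspace B" shows "subspace {y \<in> B. \<forall>x\<in>A. orthogonal x y}"
  using assms by (auto simp: subspace_def orthogonal_clauses)

lemma linear_tensor_right: "linear (tensor_op A)"
  by (rule linearI) (simp_all add: tensor_add_right tensor_scaleR_right)

lemma subspace_local_traceless: "subspace local_traceless"
proof -
  have "subspace {B :: ('a::finite) op. hermitian B \<and> trace B = 0}"
    using subspace_hermitian by (auto simp: subspace_def trace_add trace_scaleR) (simp add: trace_def)
  then show ?thesis
    unfolding local_traceless_def by (rule linear_subspace_image[OF linear_tensor_right])
qed

text \<open>Traceless Hermitian matrices form the complement of the line through
  \<open>mat 1\<close>, which costs one dimension; tensoring with the identity is injective.\<close>

lemma dim_local_traceless: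
  "dim (local_traceless :: ('n::finite) bipartite_op set) = CARD('n)\<^sup>2 - 1"
proof -
  let ?T = "{B :: 'n op. hermitian B \<and> trace B = 0}" and ?I = "mat 1 :: 'n op"
  have "trace B = of_real (?I \<bullet> B)" if "hermitian B" for B
    using trace_mult_inner[OF hermitian_mat_1 that] by simp
  moreover have "(\<forall>x\<in>span {?I}. orthogonal x B) \<longleftrightarrow> ?I \<bullet> B = 0" for B
    using span_base[of ?I "{?I}"] by (auto simp: span_singleton orthogonal_def)
  ultimately have "?T = {B \<in> {B. hermitian B}. \<forall>x\<in>span {?I}. orthogonal x B}"
    by auto
  moreover have "span {?I} \<subseteq> {B. hermitian B}"
    using span_minimal[OF _ subspace_hermitian, of "{?I}"] hermitian_mat_1 by blast
  moreover have "?I \<noteq> 0" by (simp add: vec_eq_iff mat_def)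
  ultimately have "dim ?T + 1 = CARD('n)\<^sup>2"
    using dim_subspace_orthogonal_to_vectors[OF subspace_span subspace_hermitian, of "{?I}"]
    by (simp add: dim_hermitian)
  moreover have "inj (tensor_op ?I)"
  proof (rule injI)
    fix B C :: "'n op"
    assume eq: "tensor_op ?I B = tensor_op ?I C"
    have "B $ k $ l = C $ k $ l" for k l
      using arg_cong[OF eq, of "\<lambda>A. A $ (k, k) $ (k, l)"] by (simp add: tensor_op_def mat_def)
    then show "B = C" unfolding vec_eq_iff by blast
  qed
  then have "dim (tensor_op ?I ` ?T) = dim ?T"
    by (intro dim_image_eq linear_tensor_right) (auto intro: inj_on_subset)
  ultimately show ?thesis by (simp add: local_traceless_def)
qed

text \<open>The undetected operators are the complement, among Hermitian ones, of the span of at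
  most \<open>m\<close> effects.\<close>

lemma undetected_dim:
  fixes E :: "nat \<Rightarrow> ('n::finite) op"
  assumes "povm m E"
  shows "CARD('n)\<^sup>2 \<le> dim (undetected m E) + m"
proof -
  have herm: "\<And>j. j < m \<Longrightarrow> hermitian (E j)" using assms by (auto simp: povm_def psd_def)
  let ?A = "span (E ` {..<m})"
  have "(\<forall>j<m. orthogonal (E j) y) \<longleftrightarrow> (\<forall>x\<in>?A. orthogonal x y)" for y
  proof
    assume "\<forall>j<m. orthogonal (E j) y"
    then have "\<And>x. x \<in> E ` {..<m} \<Longrightarrow> orthogonal y x"
      by (metis imageE lessThan_iff orthogonal_commute)
    then show "\<forall>x\<in>?A. orthogonal x y"
      using orthogonal_to_span orthogonal_commute by blast
  qed (blast intro: span_base)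
  then have "undetected m E = {y \<in> {A. hermitian A}. \<forall>x\<in>?A. orthogonal x y}"
    by (simp add: undetected_eq_orthogonal[OF herm])
  moreover have "?A \<subseteq> {A. hermitian A}"
    using herm by (intro span_minimal subspace_hermitian) auto
  ultimately have "dim (undetected m E) + dim ?A = CARD('n)\<^sup>2"
    using dim_subspace_orthogonal_to_vectors[OF subspace_span subspace_hermitian, of "E ` {..<m}"]
    by (simp add: dim_hermitian)
  moreover have "dim ?A \<le> card (E ` {..<m})" by (rule dim_le_card) auto
  moreover have "card (E ` {..<m}) \<le> m" using card_image_le[of "{..<m}" E] by simp
  ultimately show ?thesis by linarith
qed

section \<open>POVMs with a prescribed span\<close>

text \<open>Extend \<open>mat 1\<close> to a basis of \<open>S\<close> by
  \<open>b 0, ..., b (r - 1)\<close>. Small perturbations of the identity along each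
  \<open>b j\<close>, together with one compensating effect, are positive and, after rescaling, sum
  to the identity; they span \<open>S\<close>.\<close>

lemma povm_of_subspace:
  fixes S :: "('n::finite) op set"
  assumes S: "subspace S" "S \<subseteq> {A. hermitian A}" "mat 1 \<in> S"
  shows "\<exists>E. povm (dim S) E \<and> undetected (dim S) E = {\<Delta> \<in> {A. hermitian A}. \<forall>C\<in>S. orthogonal C \<Delta>}"
proof -
  let ?I = "mat 1 :: 'n op"
  have "?I \<noteq> 0" by (simp add: vec_eq_iff mat_def)
  then have indep: "independent {?I}" by simp
  have "{?I} \<subseteq> S" using S by simp
  then obtain Bs where Bs: "{?I} \<subseteq> Bs" "Bs \<subseteq> S" "independent Bs" "S \<subseteq> span Bs"
    using indep by (rule maximal_independent_subset_extend)
  define r where "r = card (Bs - {?I})"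
  have fin: "finite Bs" using Bs(3) by (rule independent_imp_finite)
  then have "card Bs = Suc r" unfolding r_def using Bs(1) by (intro card.remove) auto
  then have dim: "dim S = Suc r" using basis_card_eq_dim[OF Bs(2,4,3)] by simp
  obtain b where b: "bij_betw b {..<r} (Bs - {?I})"
    using ex_bij_betw_nat_finite[of "Bs - {?I}"] fin by (auto simp: r_def atLeast0LessThan)
  then have b_image: "b ` {..<r} = Bs - {?I}" by (simp add: bij_betw_def)
  then have bS: "b j \<in> S" if "j < r" for j using that Bs(2) by auto
  have "\<exists>e>0. \<forall>t. \<bar>t\<bar> \<le> e \<longrightarrow> psd (?I + t *\<^sub>R b j)" if "j < r" for j
    using psd_perturb_identity[of "b j"] bS[OF that] S(2) by blast
  then have "\<forall>j\<in>{..<r}. \<exists>e>0. \<forall>t. \<bar>t\<bar> \<le> e \<longrightarrow> psd (?I + t *\<^sub>R b j)" by blast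
  from bchoice[OF this] obtain e where e: "\<And>j. j < r \<Longrightarrow> e j > 0"
    "\<And>j t. j < r \<Longrightarrow> \<bar>t\<bar> \<le> e j \<Longrightarrow> psd (?I + t *\<^sub>R b j)" by blast
  \<comment> \<open>The total perturbation, which the last effect has to subtract.\<close>
  define C where "C = (\<Sum>j<r. e j *\<^sub>R b j)"
  have CS: "C \<in> S" unfolding C_def
    by (intro subspace_sum subspace_scale S(1) bS) auto
  obtain e0 where e0: "e0 > 0" "\<And>t. \<bar>t\<bar> \<le> e0 \<Longrightarrow> psd (?I + t *\<^sub>R C)"
    using psd_perturb_identity[of C] CS S(2) by blast
  \<comment> \<open>\<open>s \<le> 1\<close> keeps each \<open>s * e j\<close> within its admissible
    range, \<open>s \<le> e0\<close> keeps the compensating effect positive, and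
    \<open>s > 0\<close> keeps every \<open>b j\<close> recoverable from the effects.\<close>
  define s where "s = min 1 e0"
  have s: "0 < s" "s \<le> 1" "s \<le> e0" using e0 by (auto simp: s_def)
  define F where "F j = (if j < r then ?I + (s * e j) *\<^sub>R b j else ?I + (- s) *\<^sub>R C)" for j
  define E where "E j = (1 / real (Suc r)) *\<^sub>R F j" for j
  have FS: "F j \<in> S" for j
    using subspace_add[OF S(1,3) subspace_scale[OF S(1) bS]]
      subspace_add[OF S(1,3) subspace_scale[OF S(1) CS]]
    by (simp only: F_def split: if_splits) simp
  have "psd (F j)" for j
  proof (cases "j < r")
    case True
    have "s * e j \<le> 1 * e j" using s e(1)[OF True] by (intro mult_right_mono) auto
    then show ?thesis using True s e[OF True] by (simp add: F_def abs_mult)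
  next
    case False
    then show ?thesis using e0(2)[of "-s"] s by (simp add: F_def)
  qed
  then have "psd (E j)" for j by (simp add: E_def psd_scaleR)
  moreover have sum_F: "(\<Sum>j<Suc r. F j) = real (Suc r) *\<^sub>R ?I"
  proof -
    have "(\<Sum>j<r. F j) = (\<Sum>j<r. ?I) + s *\<^sub>R C"
      by (simp add: F_def C_def scaleR_sum_right sum.distrib)
    then show ?thesis
      unfolding sum.lessThan_Suc sum_constant_scaleR
      by (simp add: F_def scaleR_left_distrib)
  qed
  then have "(\<Sum>j<Suc r. E j) = ?I"
    unfolding E_def scaleR_sum_right[symmetric] by simp
  ultimately have povm: "povm (dim S) E" unfolding povm_def dim by blast
  have "undetected (dim S) E = {\<Delta> \<in> {A. hermitian A}. \<forall>C\<in>S. orthogonal C \<Delta>}"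
  proof (intro set_eqI iffI)
    fix \<Delta> assume "\<Delta> \<in> undetected (dim S) E"
    moreover have "hermitian (E j)" if "j < dim S" for j
      using povm that by (simp add: povm_def psd_def)
    ultimately have \<Delta>: "hermitian \<Delta>" and E0: "\<And>j. j < dim S \<Longrightarrow> E j \<bullet> \<Delta> = 0"
      by (simp_all add: undetected_eq_orthogonal orthogonal_def)
    have F0: "F j \<bullet> \<Delta> = 0" if "j < Suc r" for j
      using E0[of j] that dim by (simp add: E_def)
    \<comment> \<open>Orthogonality to the sum gives orthogonality to \<open>mat 1\<close>;
      subtracting it from \<open>F j\<close> then isolates \<open>b j\<close>.\<close>
    have "(\<Sum>j<Suc r. F j) \<bullet> \<Delta> = 0"
      unfolding inner_sum_left by (intro sum.neutral ballI F0) simp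
    then have I0: "?I \<bullet> \<Delta> = 0" unfolding sum_F by simp
    have b0: "b j \<bullet> \<Delta> = 0" if "j < r" for j
      using F0[of j] I0 e(1)[OF that] s that by (simp add: F_def inner_add_left)
    have Bs0: "orthogonal \<Delta> y" if "y \<in> Bs" for y
    proof (cases "y = ?I")
      case True
      then show ?thesis using I0 by (simp only: orthogonal_def inner_commute)
    next
      case False
      then have "y \<in> b ` {..<r}" using b_image that by blast
      then show ?thesis using b0 by (auto simp: orthogonal_def inner_commute)
    qed
    have "orthogonal C \<Delta>" if "C \<in> S" for C
      using orthogonal_to_span[OF _ Bs0] that Bs(4) by (auto simp: orthogonal_commute)
    then show "\<Delta> \<in> {\<Delta> \<in> {A. hermitian A}. \<forall>C\<in>S. orthogonal C \<Delta>}" using \<Delta> by simp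
  next
    fix \<Delta> assume "\<Delta> \<in> {\<Delta> \<in> {A. hermitian A}. \<forall>C\<in>S. orthogonal C \<Delta>}"
    moreover have "E j \<in> S" for j unfolding E_def by (intro subspace_scale S(1) FS)
    moreover from this have "hermitian (E j)" for j using S(2) by blast
    ultimately show "\<Delta> \<in> undetected (dim S) E" by (simp add: undetected_eq_orthogonal)
  qed
  with povm show ?thesis by blast
qed

text \<open>Subtraction of naturals truncates; the two inequalities guarantee that no truncation
  occurs.\<close>

lemma outcome_count:
  fixes d :: nat assumes "d \<ge> 1"
  shows "d^4 - (d\<^sup>2 - 1) = d^4 - d\<^sup>2 + 1" "d\<^sup>2 \<ge> 1" "d\<^sup>2 \<le> d^4"
proof -
  show "d\<^sup>2 \<ge> 1" "d\<^sup>2 \<le> d^4" using assms by (simp_all add: power_increasing)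
  then show "d^4 - (d\<^sup>2 - 1) = d^4 - d\<^sup>2 + 1" by linarith
qed

text \<open>Let the effects span the orthogonal complement \<open>S\<close> of
  \<open>local_traceless\<close>, which contains \<open>mat 1\<close> by tracelessness. The
  undetected operators are then the double complement.\<close>

lemma povm_with_undetected_local_traceless:
  fixes d :: nat
  assumes d: "CARD('n::finite) = d"
  shows "\<exists>E :: nat \<Rightarrow> 'n bipartite_op.
    povm (d^4 - d^2 + 1) E \<and> undetected (d^4 - d^2 + 1) E = local_traceless"
proof -
  let ?H = "{A :: 'n bipartite_op. hermitian A}" and ?Y = "local_traceless :: 'n bipartite_op set"
  have "d \<ge> 1" using d by (metis One_nat_def Suc_leI zero_less_card_finite)
  note count = outcome_count[OF this]
  have H: "dim ?H = d^4" using d by (simp add: dim_hermitian power_mult_distrib flip: power_add)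
  have YH: "?Y \<subseteq> ?H"
    by (auto simp: local_traceless_def hermitian_mat_1 intro: hermitian_tensor)
  define S where "S = {C \<in> ?H. \<forall>y\<in>?Y. orthogonal y C}"
  have S: "subspace S" "S \<subseteq> ?H"
    unfolding S_def by (rule subspace_orthogonal_in[OF subspace_hermitian]) blast
  have "orthogonal y (mat 1)" if "y \<in> ?Y" for y
  proof -
    have "trace y = 0" using that by (auto simp: local_traceless_def trace_tensor)
    then show ?thesis
      using trace_mult_inner[OF _ hermitian_mat_1, of y] that YH by (auto simp: orthogonal_def)
  qed
  then have IS: "mat 1 \<in> S" by (simp add: S_def hermitian_mat_1)
  have "dim S + dim ?Y = d^4"
    unfolding S_def H[symmetric]
    by (rule dim_subspace_orthogonal_to_vectors[OF subspace_local_traceless subspace_hermitian YH])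
  then have dims: "dim S = d^4 - d^2 + 1" "dim S + dim ?Y = d^4"
    using dim_local_traceless[where 'n='n] count unfolding d by linarith+
  let ?U = "{\<Delta> \<in> ?H. \<forall>C\<in>S. orthogonal C \<Delta>}"
  have "dim ?U + dim S = d^4"
    using dim_subspace_orthogonal_to_vectors[OF S(1) subspace_hermitian S(2)] H by simp
  \<comment> \<open>The double complement contains \<open>?Y\<close>; comparing dimensions gives
    equality.\<close>
  then have "dim ?U \<le> dim ?Y" using dims by linarith
  moreover have "?Y \<subseteq> ?U" using YH by (auto simp: S_def orthogonal_commute)
  ultimately have "?Y = ?U"
    by (intro subspace_dim_equal subspace_local_traceless subspace_orthogonal_in subspace_hermitian)
  then show ?thesis using povm_of_subspace[OF S IS] dims(1) by metis
qed

section \<open>Exchange of the two tensor factors\<close>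

text \<open>This is conjugation by the flip unitary, written entrywise.\<close>

definition swap_op :: "('n::finite) bipartite_op \<Rightarrow> 'n bipartite_op" where
  "swap_op A = (\<chi> p q. A $ prod.swap p $ prod.swap q)"

lemma swap_swap_op [simp]: "swap_op (swap_op A) = A"
  by (simp add: swap_op_def vec_eq_iff)

lemma sum_prod_swap: "(\<Sum>p\<in>UNIV. f (prod.swap p)) = (\<Sum>p\<in>UNIV. f p)"
  by (rule sum.reindex_bij_betw) simp

lemma trace_swap_op [simp]: "trace (swap_op A) = trace A"
  unfolding trace_def swap_op_def vec_lambda_beta by (rule sum_prod_swap[of "\<lambda>p. A $ p $ p"])

lemma swap_op_mult: "swap_op (A ** B) = swap_op A ** swap_op B"
  using sum_prod_swap[of "\<lambda>r. A $ p $ r * B $ r $ q" for p q]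
  by (simp add: swap_op_def matrix_matrix_mult_def vec_eq_iff)

lemma swap_op_sum: "swap_op (\<Sum>i\<in>I. A i) = (\<Sum>i\<in>I. swap_op (A i))"
  by (simp add: swap_op_def vec_eq_iff)

lemma swap_op_scaleR: "swap_op (t *\<^sub>R A) = t *\<^sub>R swap_op A"
  by (simp add: swap_op_def vec_eq_iff)

lemma swap_op_tensor: "swap_op (tensor_op A B) = tensor_op B A"
  by (simp add: swap_op_def tensor_op_def vec_eq_iff mult.commute)

lemma swap_op_mat_1: "swap_op (mat 1) = mat 1"
  by (auto simp: swap_op_def mat_def vec_eq_iff)

lemma hermitian_swap_op: "hermitian A \<Longrightarrow> hermitian (swap_op A)"
  by (rule hermitianI) (simp add: swap_op_def hermitian_cnj)

lemma psd_swap_op: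
  assumes "psd A" shows "psd (swap_op A)"
  unfolding psd_def
proof (intro conjI allI)
  show "hermitian (swap_op A)" using assms by (simp add: psd_def hermitian_swap_op)
  fix v :: "complex ^ ('a \<times> 'a)"
  let ?w = "\<chi> p. v $ prod.swap p"
  have "cinner v (swap_op A *v v) =
      (\<Sum>p\<in>UNIV. \<Sum>q\<in>UNIV. cnj (?w $ prod.swap p) * A $ prod.swap p $ prod.swap q * ?w $ prod.swap q)"
    by (simp add: cinner_form swap_op_def)
  also have "\<dots> = cinner ?w (A *v ?w)"
    unfolding cinner_form sum_prod_swap[of "\<lambda>q. cnj (?w $ p) * A $ p $ q * ?w $ q" for p]
      sum_prod_swap[of "\<lambda>p. \<Sum>q\<in>UNIV. cnj (?w $ p) * A $ p $ q * ?w $ q"] ..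
  finally show "0 \<le> Re (cinner v (swap_op A *v v))"
    using assms by (simp add: psd_def)
qed

lemma state_swap_op: "state A \<Longrightarrow> state (swap_op A)"
  by (simp add: state_def psd_swap_op)

lemma is_QC_swap_op: "is_QC (swap_op \<rho>) \<longleftrightarrow> is_CQ \<rho>"
proof -
  have "swap_op \<rho> = \<sigma> \<longleftrightarrow> \<rho> = swap_op \<sigma>" for \<sigma> by (metis swap_swap_op)
  then show ?thesis
    unfolding is_QC_def is_CQ_def by (simp add: swap_op_sum swap_op_scaleR swap_op_tensor)
qed

lemma povm_swap_op:
  assumes "povm m E" shows "povm m (\<lambda>j. swap_op (E j))"
  using assms by (auto simp: povm_def psd_swap_op swap_op_mat_1 simp flip: swap_op_sum)

text \<open>The trace is invariant under the exchange, so exchanging the factors in the effects has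
  the same statistics as exchanging them in the states.\<close>

lemma determines_swap_op:
  assumes det: "determines m E P" and Q: "\<And>\<rho>. Q (swap_op \<rho>) \<longleftrightarrow> P \<rho>"
  shows "determines m (\<lambda>j. swap_op (E j)) Q"
  unfolding determines_def
proof safe
  fix \<rho>\<^sub>1 \<rho>\<^sub>2
  assume st: "state \<rho>\<^sub>1" "Q \<rho>\<^sub>1" "state \<rho>\<^sub>2" "\<not> Q \<rho>\<^sub>2"
    and eq: "\<forall>j<m. trace (\<rho>\<^sub>1 ** swap_op (E j)) = trace (\<rho>\<^sub>2 ** swap_op (E j))"
  have "trace (swap_op \<rho> ** E j) = trace (\<rho> ** swap_op (E j))" for \<rho> j
    by (metis swap_op_mult swap_swap_op trace_swap_op)
  then have "\<forall>j<m. trace (swap_op \<rho>\<^sub>1 ** E j) = trace (swap_op \<rho>\<^sub>2 ** E j)" using eq by simp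
  moreover have "P (swap_op \<rho>\<^sub>1)" "\<not> P (swap_op \<rho>\<^sub>2)" using st Q by (metis swap_swap_op)+
  ultimately show False using det st state_swap_op unfolding determines_def by blast
qed

lemma swap_op_undetected:
  assumes "\<Delta> \<in> undetected m E" shows "swap_op \<Delta> \<in> undetected m (\<lambda>j. swap_op (E j))"
  using assms by (simp add: undetected_def hermitian_swap_op flip: swap_op_mult)

section \<open>The minimal number of outcomes for CQ and QC\<close>

text \<open>One POVM serves twice: it attains the lower bound, and its nonzero undetected operator
  shows that it is not informationally complete.\<close>

lemma minimal_outcomes:
  fixes d :: nat and P :: "('n::finite) bipartite_op \<Rightarrow> bool"
  assumes "\<And>m E. povm m E \<Longrightarrow> determines m E P \<Longrightarrow> d^4 - d^2 + 1 \<le> m"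
    and "povm (d^4 - d^2 + 1) E" "determines (d^4 - d^2 + 1) E P"
    and "\<Delta> \<in> undetected (d^4 - d^2 + 1) E" "\<Delta> \<noteq> 0"
  shows "(\<exists>m (E :: nat \<Rightarrow> 'n bipartite_op).
         povm m E \<and> determines m E P \<and> \<not> informationally_complete m E) \<and>
      (\<exists>E :: nat \<Rightarrow> 'n bipartite_op.
         povm (d^4 - d^2 + 1) E \<and> determines (d^4 - d^2 + 1) E P) \<and>
      (\<forall>m (E :: nat \<Rightarrow> 'n bipartite_op).
         povm m E \<and> determines m E P \<longrightarrow> d^4 - d^2 + 1 \<le> m)"
  using assms unfolding informationally_complete_def by blast

theorem corollary3:
  fixes d :: nat
  assumes "CARD('n::finite) = d" and "d \<ge> 2"
  shows
    "((\<exists>m (E :: nat \<Rightarrow> 'n bipartite_op).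
         povm m E \<and> determines m E is_CQ \<and> \<not> informationally_complete m E) \<and>
      (\<exists>E :: nat \<Rightarrow> 'n bipartite_op.
         povm (d^4 - d^2 + 1) E \<and> determines (d^4 - d^2 + 1) E is_CQ) \<and>
      (\<forall>m (E :: nat \<Rightarrow> 'n bipartite_op).
         povm m E \<and> determines m E is_CQ \<longrightarrow> d^4 - d^2 + 1 \<le> m)) \<and>
     ((\<exists>m (E :: nat \<Rightarrow> 'n bipartite_op).
         povm m E \<and> determines m E is_QC \<and> \<not> informationally_complete m E) \<and>
      (\<exists>E :: nat \<Rightarrow> 'n bipartite_op.
         povm (d^4 - d^2 + 1) E \<and> determines (d^4 - d^2 + 1) E is_QC) \<and>
      (\<forall>m (E :: nat \<Rightarrow> 'n bipartite_op).
         povm m E \<and> determines m E is_QC \<longrightarrow> d^4 - d^2 + 1 \<le> m))"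
proof -
  let ?Y = "local_traceless :: 'n bipartite_op set"
  have Y: "dim ?Y = d\<^sup>2 - 1" using assms(1) by (simp add: dim_local_traceless)
  have lower_CQ: "d^4 - d^2 + 1 \<le> m"
    if "povm m E" "determines m E is_CQ" for m and E :: "nat \<Rightarrow> 'n bipartite_op"
  proof -
    have "undetected m E \<subseteq> ?Y"
      using undetected_subset_local_traceless[OF that] assms by simp
    then have "dim (undetected m E) \<le> d\<^sup>2 - 1" using dim_subset Y by metis
    moreover have "d^4 \<le> dim (undetected m E) + m"
      using undetected_dim[OF that(1)] assms(1) by (simp add: power_mult_distrib flip: power_add)
    ultimately show ?thesis using outcome_count[of d] assms(2) by linarith
  qed
  have CQ_QC: "is_CQ (swap_op \<rho>) \<longleftrightarrow> is_QC \<rho>" for \<rho> :: "'n bipartite_op"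
    by (metis is_QC_swap_op swap_swap_op)
  \<comment> \<open>Exchanging the factors turns a POVM for QC into one for CQ with the same number
    of outcomes.\<close>
  have lower_QC: "d^4 - d^2 + 1 \<le> m"
    if "povm m E" "determines m E is_QC" for m and E :: "nat \<Rightarrow> 'n bipartite_op"
    using lower_CQ[OF povm_swap_op determines_swap_op] that CQ_QC by blast
  obtain E :: "nat \<Rightarrow> 'n bipartite_op" where E: "povm (d^4 - d^2 + 1) E"
    "undetected (d^4 - d^2 + 1) E = ?Y"
    using povm_with_undetected_local_traceless[OF assms(1)] by blast
  have det: "determines (d^4 - d^2 + 1) E is_CQ"
    by (rule determines_CQ_if_undetected_local) (simp only: E(2) subset_refl)
  \<comment> \<open>For \<open>d \<ge> 2\<close> the dimension \<open>d\<^sup>2 - 1\<close> is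
    positive, which provides a nonzero undetected operator.\<close>
  have "2\<^sup>2 \<le> d\<^sup>2" using assms(2) by (intro power_mono) auto
  then have "dim ?Y \<noteq> 0" using Y by simp
  then obtain \<Delta> where \<Delta>: "\<Delta> \<in> ?Y" "\<Delta> \<noteq> 0" by (auto simp: dim_eq_0)
  have "swap_op \<Delta> \<noteq> 0" using \<Delta>(2) by (metis scaleR_zero_left swap_op_scaleR swap_swap_op)
  with E det \<Delta> show ?thesis
    using minimal_outcomes[OF lower_CQ E(1) det _ \<Delta>(2)]
      minimal_outcomes[OF lower_QC povm_swap_op[OF E(1)] determines_swap_op[OF det is_QC_swap_op]
        swap_op_undetected]
    by (intro conjI) auto
qed

end
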